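(* Let $E:\mathbb{R}^n\to\mathbb{R}^n$ be monotone and Lipschitz continuous with constant $L>0$, and assume that $X^*=\{x\in\mathbb{R}^n: E(x)=0\}$ is nonempty. Let $\{x_\ell\}_{\ell\ge 0}$ be the infinite sequence generated by the projection-based subspace algorithm with the exact projection rule described in the context (in either its line-search version or its fixed-step version). (i) Baseline best-iterate complexity. There is a constant $C_{\rm sub}>0$ such that for every target accuracy $\varepsilon>0$ there exists an index $k_\varepsilon\ge0$ with $\|E(x_{k_\varepsilon})\|\le\varepsilon$ and $$k_\varepsilon\le\lceil C_{\rm sub}\,\varepsilon^{-2}\rceil-1=O(\varepsilon^{-2}),$$ where $C_{\rm sub}$ is independent of $\varepsilon$. (ii) Local linear-regime complexity. Suppose, in addition, that at the limit point $x^*\in X^*$ of $\{x_\ell\}$ the operator $E$ is continuously differentiable on an open neighborhood of $x^*$ and $\sigma_{\min}(J_E(x^* ))>0$. Then there exist an index $\ell_0\ge0$ and constants $q\in(0,1)$ and $C_{\rm lin}>0$ such that the first index $\ell_\varepsilon:=\min\{\ell\ge\ell_0:\|E(x_\ell)\|\le\varepsilon\}$ satisfies $$\ell_\varepsilon\le\ell_0+\max\left\{0,\left\lceil\frac{\log(C_{\rm lin}/\varepsilon)}{\log(1/q)}\right\rceil\right\}=O(\log\varepsilon^{-1}).$$ (iii) Residual-evaluation complexity. For the line-search version, suppose that the backtracking procedure uses a factor $\gamma>1$, starts from $\mu_{\rm init}>0$, and generates trial step sizes by the safeguarded update $\mu\leftarrow\max\{\mu/\gamma,\mu_{\min}\}$,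 where $$\mu_{\min}=\min\left\{\mu_{\rm init},\frac{\Delta_a}{\gamma(L+\rho)}\right\}>0$$ is the uniform lower bound on the accepted step sizes. Then the number of line-search residual evaluations at each iteration is bounded above by $$C_{\rm LS}:=1+\left\lceil\frac{\log(\mu_{\rm init}/\mu_{\min})}{\log\gamma}\right\rceil.$$ If at most one additional residual evaluation is required outside the line search at each iteration, then the total number of residual evaluations through iteration $\ell$ satisfies $N_{\rm eval}(\ell)\le(C_{\rm LS}+1)(\ell+1)$. Consequently, the number $N_{\rm eval}$ of residual evaluations is $O(C_{\rm LS}\,\varepsilon^{-2})$ for the baseline best-iterate guarantee of (i), and $O(C_{\rm LS}\log\varepsilon^{-1})$ in the local linear regime of (ii).
   Context: Setting. $\|\cdot\|$ is the Euclidean norm on $\mathbb{R}^n$. $E:\mathbb{R}^n\to\mathbb{R}^n$ is continuous and monotone, i.e. $(E(x_1)-E(x_2))^T(x_1-x_2)\ge 0$ for all $x_1,x_2\in\mathbb{R}^n$. $P_C$ denotes the Euclidean projection onto a nonempty closed convex set $C$; $J_E$ is the Jacobian of $E$ and $\sigma_{\min}(\cdot)$ the smallest singular value. The sequence generated by the algorithm converges to a point of $X^*$, called its limit point. $O(\cdot)$ in $\varepsilon$ refers to $\varepsilon\to0^+$. A residual evaluation is one evaluation of $E$ at a point; line-search residual evaluations are the evaluations of $E$ at the trial points $x_\ell+\mu p_\ell^{\rm sc}$ tested in step (1). $N_{\rm eval}(\ell)$ is the total number of residual evaluations through iteration $\ell$, and $N_{\rm eval}$ is this number at the index $k_\varepsilon$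 (resp. $\ell_\varepsilon$). Parameters: $\Delta_a\in(0,1)$, $\rho\in(0,1)$, $\gamma>1$, $\mu_{\rm init}\in(0,1]$, $\zeta\in(0,1)$, $-\infty<\beta_{\min}\le\beta_{\max}<\infty$; $L$ is the Lipschitz constant of $E$. Algorithm (exact projection rule). Given $x_0\in\mathbb{R}^n$, set $p_0=p_0^{\rm sc}=-E(x_0)$. For $\ell=0,1,2,\dots$, as long as $E(x_\ell)\ne 0$ (the algorithm stops when $E(x_\ell)=0$, so an infinite sequence has $E(x_\ell)\neq0$ for all $\ell$): (1) Step size. One of two versions is used throughout. Line-search version: $\mu_\ell$ is the first trial value $\mu$, starting from $\mu=\mu_{\rm init}$ and updated after each rejection by $\mu\leftarrow\max\{\mu/\gamma,\mu_{\min}\}$, such that $(p_\ell^{\rm sc})^TE(x_\ell+\mu p_\ell^{\rm sc})\le-\rho\,\mu\|p_\ell^{\rm sc}\|^2$; here $0<\mu_{\min}\le\min\{\mu_{\rm init},\Delta_a/(L+\rho)\}$. Fixed-step version: $\mu_\ell=\alpha$ for all $\ell$, where $0<\alpha\le\min\{1,\Delta_a/(L+\rho)\}$. In both versions set $\bar x_\ell=x_\ell+\mu_\ell p_\ell^{\rm sc}$. (2) Projection. Set $x_{\ell+1}=P_{\overline H_\ell}(x_\ell)$ with $\overline H_\ell=\{x:(x-\bar x_\ell)^TE(\bar x_\ell)\le 0\}$; equivalently $x_{\ell+1}=x_\ell-\lambda_\ell E(\bar x_\ell)$ with $\lambda_\ell=(x_\ell-\bar x_\ell)^TE(\bar x_\ell)/\|E(\bar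 x_\ell)\|^2$. (3) Direction. If $E(x_{\ell+1})\neq 0$, compute $p_{\ell+1}$ and $p_{\ell+1}^{\rm sc}$ by the direction rule below. Direction rule at index $\ell\ge1$. Write $E_\ell=E(x_\ell)$, $p=p_{\ell-1}$ (the unscaled, angle-safeguarded previous direction), $s=\bar x_{\ell-1}-x_{\ell-1}$, $y=E(\bar x_{\ell-1})-E(x_{\ell-1})$. First $y$ is safeguarded: if $s^Ty=0$, replace $y$ by $y+\varphi s$ with some $0<\varphi\le\overline\varphi$; if then $y^Tp=0$, put $u=p-\frac{s^Tp}{\|s\|^2}s$ and replace $y$ by $y+\psi\|s\|u/\|u\|$ with some $0<\psi\le\overline\psi$ ($\overline\varphi,\overline\psi>0$ constants). One of the following families, with one coefficient formula, is fixed for the whole run; every coefficient is truncated to $[\beta_{\min},\beta_{\max}]$: (a) $p_\ell=-E_\ell+\beta_\ell p$, with $\beta_\ell$ one of $\frac{\|E_\ell\|^2}{\|E_{\ell-1}\|^2}$, $\frac{y^TE_\ell}{\|E_{\ell-1}\|^2}$, $\frac{y^TE_\ell}{y^Tp}$, $\frac{\|E_\ell\|^2}{y^Tp}$, $-\frac{E_\ell^Ty}{E_{\ell-1}^Tp}$, $\frac{E_\ell^T(y-2\frac{\|y\|^2}{y^Tp}p)}{y^Tp}$, $\frac{E_\ell^T(y-0.1\,p)}{y^Tp}$; (b) $p_\ell=-E_\ell+\beta^1_\ell p+\beta^2_\ell y$, with $(\beta^1_\ell,\beta^2_\ell)$ equal to $\left(\frac{y^TE_\ell}{\|E_{\ell-1}\|^2},-\frac{p^TE_\ell}{\|E_{\ell-1}\|^2}\right)$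 or $\left(\frac{y^TE_\ell}{y^Tp},-\frac{p^TE_\ell}{y^Tp}\right)$; (c) $p_\ell=-E_\ell+\beta^3_\ell y+\beta^4_\ell s$, with $\beta^3_\ell=-\frac{s^TE_\ell}{y^Ts}$, $\beta^4_\ell=c_\ell\beta^3_\ell+\frac{y^TE_\ell}{y^Ts}$, where, for $\phi=\|y\|^2/(y^Ts)$, $c_\ell$ is one of $1+\phi$, $1+2\phi$, $1-\min\{1,\phi\}$; (d) $p_\ell=-E_\ell+\beta_\ell p+\beta^5_\ell h_\ell$, with $\beta_\ell$ one of the coefficients in (a), $h_\ell$ an auxiliary vector with $E_\ell^Th_\ell\ne0$, $\beta^5_\ell=-\frac{(\gamma_\ell-1)\|E_\ell\|^2+\beta_\ell E_\ell^Tp}{E_\ell^Th_\ell}$, $\gamma_\ell=\max\{\varsigma_1,\min\{\varsigma_2,\bar\gamma_\ell\}\}$, $0<\varsigma_1\le1<\varsigma_2$, and, for a constant $\overline\gamma>0$ and $R=\frac{E_\ell^Tp}{\|E_{\ell-1}\|\,\|p\|}$, $\bar\gamma_\ell$ one of $1\pm\overline\gamma|\beta_\ell R|$, $1\pm\overline\gamma\beta_\ell R$, $1\pm\overline\gamma|R|$, $1\pm\overline\gamma R$. If $p_\ell=0$, set $p_\ell=-E_\ell$. Angle safeguard: if the angle condition $\frac{p_\ell^TE_\ell}{\|p_\ell\|\|E_\ell\|}\le-\Delta_a$ fails, let $\sigma_1=\|E_\ell\|^2$, $\sigma_2=\|p_\ell\|^2$, $\sigma=E_\ell^Tp_\ell$,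 $w=\frac{\sigma_1\sigma_2-\sigma^2}{1-\Delta_a^2}$; replace $p_\ell$ by $p_\ell-\frac{\sigma+\Delta_a\sqrt w}{\sigma_1}E_\ell$ if $w>0$ and by $-E_\ell$ if $w=0$. (The resulting $p_\ell$ satisfies the angle condition.) Scaling: $p_\ell^{\rm sc}=\frac{\operatorname{mid}\{\zeta\|E_\ell\|,\|p_\ell\|,\|E_\ell\|\}}{\|p_\ell\|}p_\ell$, where $\operatorname{mid}$ is the median of three numbers; hence $\zeta\|E_\ell\|\le\|p_\ell^{\rm sc}\|\le\|E_\ell\|$. *)

theory Defs
  imports "HOL-Analysis.Analysis" "HOL-Library.Landau_Symbols"
begin

record alg_params =
  Delta_a :: real
  rho :: real
  zeta :: real
  beta_min :: real
  beta_max :: real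
  phi_max :: real
  psi_max :: real
  varsigma1 :: real
  varsigma2 :: real
  gamma_over :: real

definition valid_params :: "alg_params \<Rightarrow> bool" where
  "valid_params P \<longleftrightarrow>
     0 < Delta_a P \<and> Delta_a P < 1 \<and>
     0 < rho P \<and> rho P < 1 \<and>
     0 < zeta P \<and> zeta P < 1 \<and>
     beta_min P \<le> beta_max P \<and>
     0 < phi_max P \<and> 0 < psi_max P \<and>
     0 < varsigma1 P \<and> varsigma1 P \<le> 1 \<and> 1 < varsigma2 P \<and>
     0 < gamma_over P"


subsection \<open>Step sizes\<close>

text \<open>
  \<open>Line_Search \<gamma> \<mu>\<^sub>i\<^sub>n\<^sub>i\<^sub>t \<mu>\<^sub>m\<^sub>i\<^sub>n\<close> is the backtracking version,
  \<open>Fixed_Step \<alpha>\<close> the constant-step version.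
\<close>

datatype step_rule = Line_Search real real real | Fixed_Step real

fun valid_step_rule :: "alg_params \<Rightarrow> real \<Rightarrow> step_rule \<Rightarrow> bool" where
  "valid_step_rule P L (Line_Search \<gamma> \<mu>init \<mu>min) \<longleftrightarrow>
     1 < \<gamma> \<and> 0 < \<mu>init \<and> \<mu>init \<le> 1 \<and>
     0 < \<mu>min \<and> \<mu>min \<le> min \<mu>init (Delta_a P / (L + rho P))"
| "valid_step_rule P L (Fixed_Step \<alpha>) \<longleftrightarrow>
     0 < \<alpha> \<and> \<alpha> \<le> min 1 (Delta_a P / (L + rho P))"

primrec trial_step :: "real \<Rightarrow> real \<Rightarrow> real \<Rightarrow> nat \<Rightarrow> real" where
  "trial_step \<gamma> \<mu>init \<mu>min 0 = \<mu>init"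
| "trial_step \<gamma> \<mu>init \<mu>min (Suc j) = max (trial_step \<gamma> \<mu>init \<mu>min j / \<gamma>) \<mu>min"

definition accepted ::
  "('a::euclidean_space \<Rightarrow> 'a) \<Rightarrow> alg_params \<Rightarrow> 'a \<Rightarrow> 'a \<Rightarrow> real \<Rightarrow> bool" where
  "accepted E P x d \<mu> \<longleftrightarrow> d \<bullet> E (x + \<mu> *\<^sub>R d) \<le> - rho P * \<mu> * (norm d)\<^sup>2"

fun is_step_size ::
  "('a::euclidean_space \<Rightarrow> 'a) \<Rightarrow> alg_params \<Rightarrow> step_rule \<Rightarrow> 'a \<Rightarrow> 'a \<Rightarrow> real \<Rightarrow> bool" where
  "is_step_size E P (Line_Search \<gamma> \<mu>init \<mu>min) x d \<mu> \<longleftrightarrow>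
     (\<exists>j. \<mu> = trial_step \<gamma> \<mu>init \<mu>min j \<and>
          accepted E P x d (trial_step \<gamma> \<mu>init \<mu>min j) \<and>
          (\<forall>i<j. \<not> accepted E P x d (trial_step \<gamma> \<mu>init \<mu>min i)))"
| "is_step_size E P (Fixed_Step \<alpha>) x d \<mu> \<longleftrightarrow> \<mu> = \<alpha>"


subsection \<open>Search directions\<close>

datatype cg_formula = FR | PRP | HS | DY | LS | HZ | DL

datatype tt_formula = TT_PRP | TT_HS

datatype qn_formula = One_Plus_Phi | One_Plus_Two_Phi | One_Minus_Min

datatype pm_sign = Plus_Sign | Minus_Sign

datatype damp_formula = Abs_Beta_R | Beta_R | Abs_R | Only_R

datatype direction_family =
    Family_A cg_formula
  | Family_B tt_formula
  | Family_C qn_formula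
  | Family_D cg_formula pm_sign damp_formula

text \<open>
  In the coefficient formulas below, \<open>g\<close> and \<open>g'\<close> are the values of \<open>E\<close> at the current and at
  the previous iterate, \<open>p\<close> is the previous unscaled direction, \<open>s\<close> the previous trial
  displacement and \<open>y\<close> the safeguarded residual difference.
\<close>

fun cg_coeff :: "cg_formula \<Rightarrow> 'a::euclidean_space \<Rightarrow> 'a \<Rightarrow> 'a \<Rightarrow> 'a \<Rightarrow> real" where
  "cg_coeff FR g g' p y = (norm g)\<^sup>2 / (norm g')\<^sup>2"
| "cg_coeff PRP g g' p y = (y \<bullet> g) / (norm g')\<^sup>2"
| "cg_coeff HS g g' p y = (y \<bullet> g) / (y \<bullet> p)"
| "cg_coeff DY g g' p y = (norm g)\<^sup>2 / (y \<bullet> p)"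
| "cg_coeff LS g g' p y = - (g \<bullet> y) / (g' \<bullet> p)"
| "cg_coeff HZ g g' p y = (g \<bullet> (y - (2 * (norm y)\<^sup>2 / (y \<bullet> p)) *\<^sub>R p)) / (y \<bullet> p)"
| "cg_coeff DL g g' p y = (g \<bullet> (y - (1 / 10) *\<^sub>R p)) / (y \<bullet> p)"

fun tt_coeffs :: "tt_formula \<Rightarrow> 'a::euclidean_space \<Rightarrow> 'a \<Rightarrow> 'a \<Rightarrow> 'a \<Rightarrow> real \<times> real" where
  "tt_coeffs TT_PRP g g' p y = ((y \<bullet> g) / (norm g')\<^sup>2, - (p \<bullet> g) / (norm g')\<^sup>2)"
| "tt_coeffs TT_HS g g' p y = ((y \<bullet> g) / (y \<bullet> p), - (p \<bullet> g) / (y \<bullet> p))"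

fun qn_factor :: "qn_formula \<Rightarrow> real \<Rightarrow> real" where
  "qn_factor One_Plus_Phi \<phi> = 1 + \<phi>"
| "qn_factor One_Plus_Two_Phi \<phi> = 1 + 2 * \<phi>"
| "qn_factor One_Minus_Min \<phi> = 1 - min 1 \<phi>"

fun sign_val :: "pm_sign \<Rightarrow> real" where
  "sign_val Plus_Sign = 1"
| "sign_val Minus_Sign = -1"

fun damp_term :: "damp_formula \<Rightarrow> real \<Rightarrow> real \<Rightarrow> real" where
  "damp_term Abs_Beta_R \<beta> R = \<bar>\<beta> * R\<bar>"
| "damp_term Beta_R \<beta> R = \<beta> * R"
| "damp_term Abs_R \<beta> R = \<bar>R\<bar>"
| "damp_term Only_R \<beta> R = R"

definition trunc :: "alg_params \<Rightarrow> real \<Rightarrow> real" where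
  "trunc P b = max (beta_min P) (min (beta_max P) b)"

text \<open>
  A coefficient that enters the formula of a later one does so in truncated form. The vector
  \<open>h\<close> is only used by the last family.
\<close>

fun raw_direction ::
  "alg_params \<Rightarrow> direction_family \<Rightarrow> 'a::euclidean_space \<Rightarrow> 'a \<Rightarrow> 'a \<Rightarrow> 'a \<Rightarrow> 'a \<Rightarrow> 'a \<Rightarrow> 'a" where
  "raw_direction P (Family_A f) g g' p s y h =
     - g + trunc P (cg_coeff f g g' p y) *\<^sub>R p"
| "raw_direction P (Family_B f) g g' p s y h =
     (let (b1, b2) = tt_coeffs f g g' p y
      in - g + trunc P b1 *\<^sub>R p + trunc P b2 *\<^sub>R y)"
| "raw_direction P (Family_C f) g g' p s y h =
     (let c = qn_factor f ((norm y)\<^sup>2 / (y \<bullet> s));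
          \<beta>3 = trunc P (- (s \<bullet> g) / (y \<bullet> s));
          \<beta>4 = trunc P (c * \<beta>3 + (y \<bullet> g) / (y \<bullet> s))
      in - g + \<beta>3 *\<^sub>R y + \<beta>4 *\<^sub>R s)"
| "raw_direction P (Family_D f sg d) g g' p s y h =
     (let \<beta> = trunc P (cg_coeff f g g' p y);
          R = (g \<bullet> p) / (norm g' * norm p);
          \<gamma>b = 1 + sign_val sg * gamma_over P * damp_term d \<beta> R;
          \<gamma> = max (varsigma1 P) (min (varsigma2 P) \<gamma>b);
          \<beta>5 = trunc P (- ((\<gamma> - 1) * (norm g)\<^sup>2 + \<beta> * (g \<bullet> p)) / (g \<bullet> h))
      in - g + \<beta> *\<^sub>R p + \<beta>5 *\<^sub>R h)"

text \<open>
  The constants \<open>\<phi>\<close> and \<open>\<psi>\<close> may be chosen anew each time the safeguard is applied.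
\<close>

definition safeguarded_difference ::
  "alg_params \<Rightarrow> 'a::euclidean_space \<Rightarrow> 'a \<Rightarrow> 'a \<Rightarrow> 'a \<Rightarrow> bool" where
  "safeguarded_difference P p s y0 y \<longleftrightarrow>
     (\<exists>y1.
        (if s \<bullet> y0 = 0
         then \<exists>\<phi>. 0 < \<phi> \<and> \<phi> \<le> phi_max P \<and> y1 = y0 + \<phi> *\<^sub>R s
         else y1 = y0) \<and>
        (if y1 \<bullet> p = 0
         then let u = p - ((s \<bullet> p) / (norm s)\<^sup>2) *\<^sub>R s
              in \<exists>\<psi>. 0 < \<psi> \<and> \<psi> \<le> psi_max P \<and> y = y1 + (\<psi> * norm s / norm u) *\<^sub>R u
         else y = y1))"

definition angle_safeguard :: "alg_params \<Rightarrow> 'a::euclidean_space \<Rightarrow> 'a \<Rightarrow> 'a" where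
  "angle_safeguard P g p =
     (if (p \<bullet> g) / (norm p * norm g) \<le> - Delta_a P then p
      else let \<sigma>1 = (norm g)\<^sup>2;
               \<sigma>2 = (norm p)\<^sup>2;
               \<sigma> = g \<bullet> p;
               w = (\<sigma>1 * \<sigma>2 - \<sigma>\<^sup>2) / (1 - (Delta_a P)\<^sup>2)
           in if w > 0 then p - ((\<sigma> + Delta_a P * sqrt w) / \<sigma>1) *\<^sub>R g else - g)"

definition is_direction ::
  "('a::euclidean_space \<Rightarrow> 'a) \<Rightarrow> alg_params \<Rightarrow> direction_family \<Rightarrow> 'a \<Rightarrow> 'a \<Rightarrow> 'a \<Rightarrow> 'a \<Rightarrow> 'a \<Rightarrow> bool"
  where
  "is_direction E P F xprev xbar pprev x p \<longleftrightarrow>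
     (\<exists>y h r.
        safeguarded_difference P pprev (xbar - xprev) (E xbar - E xprev) y \<and>
        E x \<bullet> h \<noteq> 0 \<and>
        r = raw_direction P F (E x) (E xprev) pprev (xbar - xprev) y h \<and>
        p = angle_safeguard P (E x) (if r = 0 then - E x else r))"

definition mid :: "real \<Rightarrow> real \<Rightarrow> real \<Rightarrow> real" where
  "mid a b c = sort [a, b, c] ! 1"

definition scaled_direction :: "alg_params \<Rightarrow> 'a::euclidean_space \<Rightarrow> 'a \<Rightarrow> 'a" where
  "scaled_direction P g p = (mid (zeta P * norm g) (norm p) (norm g) / norm p) *\<^sub>R p"


subsection \<open>Infinite runs of the algorithm\<close>

definition trial_point :: "(nat \<Rightarrow> 'a::euclidean_space) \<Rightarrow> (nat \<Rightarrow> 'a) \<Rightarrow> (nat \<Rightarrow> real) \<Rightarrow> nat \<Rightarrow> 'a" where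
  "trial_point x psc \<mu> l = x l + \<mu> l *\<^sub>R psc l"

definition subspace_run ::
  "('a::euclidean_space \<Rightarrow> 'a) \<Rightarrow> alg_params \<Rightarrow> direction_family \<Rightarrow> step_rule \<Rightarrow>
   (nat \<Rightarrow> 'a) \<Rightarrow> (nat \<Rightarrow> 'a) \<Rightarrow> (nat \<Rightarrow> 'a) \<Rightarrow> (nat \<Rightarrow> real) \<Rightarrow> bool" where
  "subspace_run E P F S x p psc \<mu> \<longleftrightarrow>
     (\<forall>l. E (x l) \<noteq> 0) \<and>
     p 0 = - E (x 0) \<and> psc 0 = - E (x 0) \<and>
     (\<forall>l. is_step_size E P S (x l) (psc l) (\<mu> l)) \<and>
     (\<forall>l. x (Suc l) =
        closest_point {z. (z - trial_point x psc \<mu> l) \<bullet> E (trial_point x psc \<mu> l) \<le> 0} (x l)) \<and>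
     (\<forall>l. is_direction E P F (x l) (trial_point x psc \<mu> l) (p l) (x (Suc l)) (p (Suc l))) \<and>
     (\<forall>l. psc (Suc l) = scaled_direction P (E (x (Suc l))) (p (Suc l)))"


subsection \<open>Smallest singular value and local regularity\<close>

text \<open>
  Singular values are the square roots of the eigenvalues of \<open>A\<^sup>T A\<close>; this finite nonempty set
  has a least element, so \<open>LEAST\<close> is well defined over the reals.
\<close>

definition singular_value :: "real^'n^'n \<Rightarrow> real \<Rightarrow> bool" where
  "singular_value A \<sigma> \<longleftrightarrow> 0 \<le> \<sigma> \<and> (\<exists>v. v \<noteq> 0 \<and> (transpose A ** A) *v v = \<sigma>\<^sup>2 *\<^sub>R v)"

definition sigma_min :: "real^'n^'n \<Rightarrow> real" where
  "sigma_min A = (LEAST \<sigma>. singular_value A \<sigma>)"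

definition C1_near :: "(real^'n \<Rightarrow> real^'n) \<Rightarrow> real^'n \<Rightarrow> bool" where
  "C1_near E z \<longleftrightarrow>
     (\<exists>U. open U \<and> z \<in> U \<and> E differentiable_on U \<and> continuous_on U (\<lambda>v. jacobian E (at v)))"


subsection \<open>Complexity bounds\<close>

definition best_iterate_index ::
  "('a::euclidean_space \<Rightarrow> 'a) \<Rightarrow> (nat \<Rightarrow> 'a) \<Rightarrow> real \<Rightarrow> real \<Rightarrow> nat \<Rightarrow> bool" where
  "best_iterate_index E x C \<epsilon> k \<longleftrightarrow> norm (E (x k)) \<le> \<epsilon> \<and> int k \<le> \<lceil>C / \<epsilon>\<^sup>2\<rceil> - 1"

definition first_index ::
  "('a::euclidean_space \<Rightarrow> 'a) \<Rightarrow> (nat \<Rightarrow> 'a) \<Rightarrow> nat \<Rightarrow> real \<Rightarrow> nat" where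
  "first_index E x l0 \<epsilon> = (LEAST l. l0 \<le> l \<and> norm (E (x l)) \<le> \<epsilon>)"

definition linear_bound :: "nat \<Rightarrow> real \<Rightarrow> real \<Rightarrow> real \<Rightarrow> int" where
  "linear_bound l0 q C \<epsilon> = int l0 + max 0 \<lceil>ln (C / \<epsilon>) / ln (1 / q)\<rceil>"

text \<open>The first conjunct under the quantifier makes \<open>first_index\<close> meaningful.\<close>

definition linear_regime ::
  "('a::euclidean_space \<Rightarrow> 'a) \<Rightarrow> (nat \<Rightarrow> 'a) \<Rightarrow> nat \<Rightarrow> real \<Rightarrow> real \<Rightarrow> bool" where
  "linear_regime E x l0 q C \<longleftrightarrow>
     0 < q \<and> q < 1 \<and> 0 < C \<and>
     (\<forall>\<epsilon>>0. (\<exists>l\<ge>l0. norm (E (x l)) \<le> \<epsilon>) \<and> int (first_index E x l0 \<epsilon>) \<le> linear_bound l0 q C \<epsilon>)"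

text \<open>
  The line search evaluates \<open>E\<close> once per trial value, the last one being the first accepted one.
\<close>

definition ls_evals ::
  "('a::euclidean_space \<Rightarrow> 'a) \<Rightarrow> alg_params \<Rightarrow> real \<Rightarrow> real \<Rightarrow> real \<Rightarrow> 'a \<Rightarrow> 'a \<Rightarrow> nat" where
  "ls_evals E P \<gamma> \<mu>init \<mu>min x d =
     Suc (LEAST j. accepted E P x d (trial_step \<gamma> \<mu>init \<mu>min j))"

text \<open>\<open>extra i\<close> is the number of evaluations made in iteration \<open>i\<close> outside the line search.\<close>

definition N_eval ::
  "('a::euclidean_space \<Rightarrow> 'a) \<Rightarrow> alg_params \<Rightarrow> real \<Rightarrow> real \<Rightarrow> real \<Rightarrow>
   (nat \<Rightarrow> 'a) \<Rightarrow> (nat \<Rightarrow> 'a) \<Rightarrow> (nat \<Rightarrow> nat) \<Rightarrow> nat \<Rightarrow> nat" where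
  "N_eval E P \<gamma> \<mu>init \<mu>min x psc extra l =
     (\<Sum>i\<le>l. ls_evals E P \<gamma> \<mu>init \<mu>min (x i) (psc i) + extra i)"

definition C_LS :: "real \<Rightarrow> real \<Rightarrow> real \<Rightarrow> int" where
  "C_LS \<gamma> \<mu>init \<mu>min = 1 + \<lceil>ln (\<mu>init / \<mu>min) / ln \<gamma>\<rceil>"

end

theory Submission
  imports Defs
begin

text \<open>
  Every direction family is reduced to one property: whatever the coefficient formula produces,
  the angle safeguard and the scaling turn it into a direction of length between
  \<open>zeta P * norm g\<close> and \<open>norm g\<close> that makes an angle with the residual \<open>g\<close> bounded away from a
  right one (\<open>subspace_run_admissible\<close>). Along such a direction Lipschitz continuity makes every
  step of length at most \<open>Delta_a P / (L + rho P)\<close> acceptable (\<open>accepted_if_short_step\<close>). Hence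
  the steps of both versions are accepted and bounded below by a positive constant
  (\<open>step_sizes_accepted\<close>), and the backtracking stops at the latest when the trial values, which
  form a truncated geometric sequence, reach their floor (\<open>ls_evals_le\<close>).

  By monotonicity the half-space onto which the current iterate is projected contains every
  solution \<open>z\<close>, while acceptance of the step puts the iterate at a distance from that half-space
  that is at least proportional to its residual norm. Pythagoras then gives the Fejer inequality
  \<open>subspace_run_fejer\<close>: the squared distance to \<open>z\<close> drops in each iteration by at least a fixed
  multiple \<open>c\<close> of the squared residual norm.

  Both complexity bounds are read off this inequality. Summed over the iterations, it bounds the
  sum of the squared residual norms, so among the first \<open>N\<close> residuals one has square at most
  \<open>C / N\<close>. Near a solution with nonsingular Jacobian, the residual norm dominates a multiple
  \<open>m\<close> of the distance (\<open>local_error_bound\<close>), so the same inequality contracts the squared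
  distance by the factor \<open>1 - c * m\<^sup>2\<close>. The evaluation counts are these
  index bounds times the bounded cost of one iteration.
\<close>


section \<open>Search directions\<close>

text \<open>
  All that the convergence analysis retains of the search direction \<open>d\<close> at a point with residual
  \<open>g\<close>. The angle condition is stated without division, so that it also makes sense for vanishing
  vectors.
\<close>

definition admissible_direction :: "alg_params \<Rightarrow> 'a::euclidean_space \<Rightarrow> 'a \<Rightarrow> bool" where
  "admissible_direction P g d \<longleftrightarrow>
     zeta P * norm g \<le> norm d \<and> norm d \<le> norm g \<and> d \<bullet> g \<le> - Delta_a P * (norm d * norm g)"

lemma mid_between:
  assumes "a \<le> c"
  shows "a \<le> mid a b c" "mid a b c \<le> c"
  using assms by (auto simp: mid_def)

text \<open>
  In the tilted case \<open>d\<close> arises from \<open>r\<close> by changing only the component along \<open>g\<close>. The amount of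
  the change is such that \<open>d \<bullet> g = - Delta_a P * sqrt w\<close>, and the definition of \<open>w\<close> is such that
  then \<open>norm d * norm g = sqrt w\<close>: the angle condition holds with equality.
\<close>

lemma angle_safeguard_angle:
  fixes g r :: "'a::euclidean_space"
  assumes "0 < Delta_a P" "Delta_a P < 1" and g: "g \<noteq> 0" and r: "r \<noteq> 0"
  defines "d \<equiv> angle_safeguard P g r"
  shows "d \<noteq> 0 \<and> d \<bullet> g \<le> - Delta_a P * (norm d * norm g)"
proof -
  let ?D = "Delta_a P"
  define w where "w = ((norm g)\<^sup>2 * (norm r)\<^sup>2 - (g \<bullet> r)\<^sup>2) / (1 - ?D\<^sup>2)"
  have D2: "1 - ?D\<^sup>2 > 0"
    using assms(1,2) by (simp add: power_less_one_iff)
  have reset: ?thesis if "d = - g"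
  proof -
    have "?D * (norm g * norm g) \<le> 1 * (norm g * norm g)"
      by (rule mult_right_mono) (use assms(2) in auto)
    then show ?thesis
      using that g by (simp add: power2_norm_eq_inner[symmetric] power2_eq_square)
  qed
  consider (keep) "(r \<bullet> g) / (norm r * norm g) \<le> - ?D" "d = r"
    | (tilt) "w > 0" "d = r - ((g \<bullet> r + ?D * sqrt w) / (norm g)\<^sup>2) *\<^sub>R g"
    | (reset) "d = - g"
    unfolding d_def angle_safeguard_def Let_def w_def[symmetric] by presburger
  then show ?thesis
  proof cases
    case keep
    have "norm r * norm g > 0"
      using g r by simp
    then show ?thesis
      using keep r by (simp add: divide_le_eq)
  next
    case tilt
    define t where "t = (g \<bullet> r + ?D * sqrt w) / (norm g)\<^sup>2"
    have t: "t * (norm g)\<^sup>2 = g \<bullet> r + ?D * sqrt w"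
      using g by (simp add: t_def)
    have d: "d = r - t *\<^sub>R g"
      using tilt(2) by (simp add: t_def)
    have dd: "(norm d)\<^sup>2 = (norm r)\<^sup>2 - 2 * t * (g \<bullet> r) + t\<^sup>2 * (norm g)\<^sup>2"
      unfolding d power2_norm_eq_inner
      by (simp add: inner_diff_left inner_diff_right inner_commute[of r g] power2_eq_square algebra_simps)
    have dg: "d \<bullet> g = - ?D * sqrt w"
      using t by (simp add: d inner_diff_left inner_commute[of r] power2_norm_eq_inner)
    have w: "w * (1 - ?D\<^sup>2) = (norm g)\<^sup>2 * (norm r)\<^sup>2 - (g \<bullet> r)\<^sup>2"
      using D2 by (simp add: w_def)
    have "(norm d * norm g)\<^sup>2 = ((norm r)\<^sup>2 - 2 * t * (g \<bullet> r) + t\<^sup>2 * (norm g)\<^sup>2) * (norm g)\<^sup>2"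
      by (simp add: dd power_mult_distrib)
    also have "\<dots> = (norm r)\<^sup>2 * (norm g)\<^sup>2 - 2 * (g \<bullet> r) * (t * (norm g)\<^sup>2) + (t * (norm g)\<^sup>2)\<^sup>2"
      by (simp add: algebra_simps power2_eq_square)
    also have "\<dots> = (norm g)\<^sup>2 * (norm r)\<^sup>2 - (g \<bullet> r)\<^sup>2 + ?D\<^sup>2 * (sqrt w)\<^sup>2"
      unfolding t by (simp add: algebra_simps power2_eq_square)
    also have "\<dots> = w"
      using w tilt(1) by (simp add: algebra_simps)
    finally have "norm d * norm g = sqrt w"
      by (metis norm_ge_zero mult_nonneg_nonneg real_sqrt_unique)
    then show ?thesis
      using dg tilt(1) by auto
  qed (fact reset)
qed

lemma scaled_direction_admissible:
  fixes g d :: "'a::euclidean_space"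
  assumes "0 < zeta P" "zeta P < 1" "d \<noteq> 0" and angle: "d \<bullet> g \<le> - Delta_a P * (norm d * norm g)"
  shows "admissible_direction P g (scaled_direction P g d)"
proof -
  define m where "m = mid (zeta P * norm g) (norm d) (norm g)"
  have le: "zeta P * norm g \<le> norm g"
    using mult_right_mono[of "zeta P" 1 "norm g"] assms(2) by simp
  have m: "zeta P * norm g \<le> m" "m \<le> norm g"
    unfolding m_def by (rule mid_between[OF le])+
  have m0: "0 \<le> m"
    using m(1) assms(1) by (smt (verit) mult_nonneg_nonneg norm_ge_zero)
  have n: "norm (scaled_direction P g d) = m"
    using m0 assms(3) by (simp add: scaled_direction_def m_def)
  have "(m / norm d) * (d \<bullet> g) \<le> (m / norm d) * (- Delta_a P * (norm d * norm g))"
    by (rule mult_left_mono[OF angle]) (use m0 in simp)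
  also have "\<dots> = - Delta_a P * (m * norm g)"
    using assms(3) by simp
  finally have "scaled_direction P g d \<bullet> g \<le> - Delta_a P * (m * norm g)"
    by (simp add: scaled_direction_def m_def)
  then show ?thesis
    using m by (simp add: admissible_direction_def n)
qed

text \<open>
  The angle safeguard repairs any nonzero vector and is applied after the coefficient formula, so
  one argument covers all direction families.
\<close>

lemma subspace_run_admissible:
  fixes E :: "'a::euclidean_space \<Rightarrow> 'a"
  assumes params: "valid_params P" and run: "subspace_run E P F S x p psc \<mu>"
  shows "admissible_direction P (E (x l)) (psc l)"
proof (cases l)
  case 0
  have "Delta_a P * (norm (E (x 0)) * norm (E (x 0))) \<le> 1 * (norm (E (x 0)) * norm (E (x 0)))"
    by (rule mult_right_mono) (use params in \<open>auto simp: valid_params_def\<close>)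
  moreover have "zeta P * norm (E (x 0)) \<le> 1 * norm (E (x 0))"
    by (rule mult_right_mono) (use params in \<open>auto simp: valid_params_def\<close>)
  moreover have "psc 0 = - E (x 0)"
    using run by (simp add: subspace_run_def)
  ultimately show ?thesis
    using 0 by (simp add: admissible_direction_def power2_norm_eq_inner[symmetric] power2_eq_square)
next
  case (Suc k)
  have E: "E (x l) \<noteq> 0" and psc: "psc l = scaled_direction P (E (x l)) (p l)"
    and dir: "is_direction E P F (x k) (trial_point x psc \<mu> k) (p k) (x l) (p l)"
    using run unfolding subspace_run_def Suc by blast+
  from dir obtain r where p: "p l = angle_safeguard P (E (x l)) (if r = 0 then - E (x l) else r)"
    by (auto simp: is_direction_def)
  have "p l \<noteq> 0 \<and> p l \<bullet> E (x l) \<le> - Delta_a P * (norm (p l) * norm (E (x l)))"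
    unfolding p by (rule angle_safeguard_angle) (use params E in \<open>auto simp: valid_params_def\<close>)
  then show ?thesis
    unfolding psc using params by (intro scaled_direction_admissible) (auto simp: valid_params_def)
qed


section \<open>Step sizes\<close>

text \<open>
  The residual at the trial point differs from the one at \<open>u\<close> by at most \<open>L * \<mu> * norm d\<close>, and
  \<open>d \<bullet> E u \<le> - Delta_a P * (norm d)\<^sup>2\<close> because \<open>d\<close> is at most as long as \<open>E u\<close>. The bound on the
  step length is exactly what makes \<open>L * \<mu> - Delta_a P \<le> - rho P * \<mu>\<close>.
\<close>

lemma accepted_if_short_step:
  fixes E :: "'a::euclidean_space \<Rightarrow> 'a"
  assumes lip: "L-lipschitz_on UNIV E" and "L > 0" and params: "valid_params P"
    and adm: "admissible_direction P (E u) d" and \<mu>: "0 \<le> \<mu>" "\<mu> \<le> Delta_a P / (L + rho P)"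
  shows "accepted E P u d \<mu>"
proof -
  have pos: "0 < Delta_a P" "0 < rho P"
    using params by (auto simp: valid_params_def)
  have "d \<bullet> E (u + \<mu> *\<^sub>R d) = d \<bullet> E u + d \<bullet> (E (u + \<mu> *\<^sub>R d) - E u)"
    by (simp add: inner_diff_right)
  also have "d \<bullet> (E (u + \<mu> *\<^sub>R d) - E u) \<le> norm d * (L * (\<mu> * norm d))"
  proof -
    have "norm (E (u + \<mu> *\<^sub>R d) - E u) \<le> L * (\<mu> * norm d)"
      using lipschitz_onD[OF lip, of "u + \<mu> *\<^sub>R d" u] \<mu>(1) by (simp add: dist_norm)
    then have "norm d * norm (E (u + \<mu> *\<^sub>R d) - E u) \<le> norm d * (L * (\<mu> * norm d))"
      by (rule mult_left_mono) simp
    then show ?thesis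
      using norm_cauchy_schwarz[of d "E (u + \<mu> *\<^sub>R d) - E u"] by linarith
  qed
  also have "d \<bullet> E u \<le> - Delta_a P * (norm d * norm d)"
  proof -
    have "Delta_a P * (norm d * norm d) \<le> Delta_a P * (norm d * norm (E u))"
      using adm pos by (intro mult_left_mono) (auto simp: admissible_direction_def)
    then show ?thesis
      using adm by (simp add: admissible_direction_def)
  qed
  also have "- Delta_a P * (norm d * norm d) + norm d * (L * (\<mu> * norm d))
      = (\<mu> * (L + rho P) - Delta_a P) * (norm d)\<^sup>2 - rho P * \<mu> * (norm d)\<^sup>2"
    by (simp add: algebra_simps power2_eq_square)
  also have "(\<mu> * (L + rho P) - Delta_a P) * (norm d)\<^sup>2 \<le> 0"
    using \<mu>(2) pos \<open>L > 0\<close> by (intro mult_nonpos_nonneg) (auto simp: pos_le_divide_eq)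
  finally show ?thesis
    by (simp add: accepted_def)
qed

text \<open>
  The recursion truncates at every step. Truncating once at the end gives the same result, because
  the floor divided by \<open>\<gamma> > 1\<close> lies below the floor and is lifted back to it.
\<close>

lemma trial_step_eq:
  assumes "1 < \<gamma>" "0 < \<mu>min" "\<mu>min \<le> \<mu>init"
  shows "trial_step \<gamma> \<mu>init \<mu>min j = max (\<mu>init / \<gamma> ^ j) \<mu>min"
proof (induction j)
  case 0
  then show ?case using assms by simp
next
  case (Suc j)
  have "\<mu>min / \<gamma> \<le> \<mu>min"
    using assms by (simp add: divide_le_eq)
  moreover have "max (\<mu>init / \<gamma> ^ j) \<mu>min / \<gamma> = max (\<mu>init / \<gamma> ^ Suc j) (\<mu>min / \<gamma>)"
    using assms by (auto simp: max_def divide_right_mono field_simps)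
  ultimately show ?case
    using Suc by auto
qed

text \<open>
  The form in which logarithmic iteration counts are used below, for the trial step sizes as well
  as for the residuals in the linear regime.
\<close>

lemma geometric_decay_le:
  fixes q C \<epsilon> :: real
  assumes "0 < q" "q < 1" "0 < C" "0 < \<epsilon>" and n: "ln (C / \<epsilon>) / ln (1 / q) \<le> real n"
  shows "C * q ^ n \<le> \<epsilon>"
proof -
  have "ln (1 / q) > 0"
    using assms by simp
  then have "ln (C / \<epsilon>) \<le> n * ln (1 / q)"
    using n by (simp add: divide_le_eq)
  also have "\<dots> = ln ((1 / q) ^ n)"
    using assms by (simp add: ln_realpow)
  finally have "C / \<epsilon> \<le> (1 / q) ^ n"
    using assms by simp
  then show ?thesis
    using assms by (simp add: field_simps power_divide)
qed

lemma trial_step_reaches_min: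
  assumes "1 < \<gamma>" "0 < \<mu>min" "\<mu>min \<le> \<mu>init"
  shows "trial_step \<gamma> \<mu>init \<mu>min (nat \<lceil>ln (\<mu>init / \<mu>min) / ln \<gamma>\<rceil>) = \<mu>min"
proof -
  let ?n = "nat \<lceil>ln (\<mu>init / \<mu>min) / ln \<gamma>\<rceil>"
  have "\<mu>init * (1 / \<gamma>) ^ ?n \<le> \<mu>min"
    using assms by (intro geometric_decay_le) (auto intro: real_nat_ceiling_ge)
  then show ?thesis
    using assms by (simp add: trial_step_eq power_divide)
qed

lemma ls_evals_le:
  fixes E :: "'a::euclidean_space \<Rightarrow> 'a"
  assumes "1 < \<gamma>" "0 < \<mu>min" "\<mu>min \<le> \<mu>init" and acc: "accepted E P u d \<mu>min"
  shows "int (ls_evals E P \<gamma> \<mu>init \<mu>min u d) \<le> C_LS \<gamma> \<mu>init \<mu>min"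
proof -
  have "(LEAST j. accepted E P u d (trial_step \<gamma> \<mu>init \<mu>min j))
      \<le> nat \<lceil>ln (\<mu>init / \<mu>min) / ln \<gamma>\<rceil>"
    by (rule Least_le) (use acc assms in \<open>simp add: trial_step_reaches_min\<close>)
  moreover have "0 \<le> \<lceil>ln (\<mu>init / \<mu>min) / ln \<gamma>\<rceil>"
  proof -
    have "0 \<le> ln (\<mu>init / \<mu>min) / ln \<gamma>"
      using assms by (intro divide_nonneg_pos) (auto simp: ln_ge_zero_iff)
    then show ?thesis by linarith
  qed
  ultimately show ?thesis
    unfolding ls_evals_def C_LS_def by linarith
qed

lemma line_search_step_ge:
  assumes "is_step_size E P (Line_Search \<gamma> \<mu>init \<mu>min) u d \<mu>"
    and "1 < \<gamma>" "0 < \<mu>min" "\<mu>min \<le> \<mu>init"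
  shows "\<mu>min \<le> \<mu>"
  using assms by (auto simp: trial_step_eq)

text \<open>
  In the line search acceptance holds by construction; for a fixed step it is a consequence of the
  step being short.
\<close>

lemma step_sizes_accepted:
  fixes E :: "'a::euclidean_space \<Rightarrow> 'a"
  assumes lip: "L-lipschitz_on UNIV E" and "L > 0" and params: "valid_params P"
    and S: "valid_step_rule P L S" and run: "subspace_run E P F S x p psc \<mu>"
  shows "\<exists>m>0. \<forall>l. m \<le> \<mu> l \<and> \<mu> l \<le> 1 \<and> accepted E P (x l) (psc l) (\<mu> l)"
proof -
  have step: "is_step_size E P S (x l) (psc l) (\<mu> l)" for l
    using run by (simp add: subspace_run_def)
  show ?thesis
  proof (cases S)
    case (Line_Search \<gamma> \<mu>init \<mu>min)
    have *: "1 < \<gamma>" "0 < \<mu>min" "\<mu>min \<le> \<mu>init" "\<mu>init \<le> 1"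
      using S Line_Search by auto
    have "\<mu>min \<le> \<mu> l \<and> \<mu> l \<le> 1 \<and> accepted E P (x l) (psc l) (\<mu> l)" for l
    proof -
      obtain j where j: "\<mu> l = trial_step \<gamma> \<mu>init \<mu>min j" "accepted E P (x l) (psc l) (\<mu> l)"
        using step[of l] Line_Search by auto
      have "\<mu>init / \<gamma> ^ j \<le> \<mu>init / 1"
        using * by (intro divide_left_mono) auto
      then have "\<mu> l \<le> 1"
        using j(1) * unfolding trial_step_eq[OF *(1-3)] by linarith
      moreover have "\<mu>min \<le> \<mu> l"
        using line_search_step_ge step[of l] * unfolding Line_Search by blast
      ultimately show ?thesis
        using j by blast
    qed
    then show ?thesis
      using *(2) by blast
  next
    case (Fixed_Step \<alpha>)
    have "0 < \<alpha>" "\<alpha> \<le> 1" "\<alpha> \<le> Delta_a P / (L + rho P)" and \<mu>: "\<And>l. \<mu> l = \<alpha>"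
      using S step Fixed_Step by auto
    moreover have "accepted E P (x l) (psc l) \<alpha>" for l
      using calculation subspace_run_admissible[OF params run]
      by (intro accepted_if_short_step[OF lip \<open>L > 0\<close> params]) auto
    ultimately show ?thesis
      by auto
  qed
qed


section \<open>Decrease of the distance to the solution set\<close>

text \<open>
  The first part is the Pythagorean inequality for projections onto convex sets. The second part
  bounds the distance from \<open>u\<close> to the half-space from below; multiplying by \<open>norm e\<close> instead of
  dividing keeps it true for \<open>e = 0\<close>.
\<close>

lemma halfspace_projection:
  fixes b e u z :: "'a::euclidean_space"
  defines "H \<equiv> {v. (v - b) \<bullet> e \<le> 0}"
  defines "v \<equiv> closest_point H u"
  shows "z \<in> H \<Longrightarrow> (norm (v - z))\<^sup>2 \<le> (norm (u - z))\<^sup>2 - (norm (u - v))\<^sup>2"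
    and "(u - b) \<bullet> e \<le> norm (u - v) * norm e"
proof -
  have H: "H = {v. e \<bullet> v \<le> e \<bullet> b}"
    by (auto simp: H_def inner_diff_left inner_commute[of e])
  have cc: "closed H" "convex H" and ne: "b \<in> H"
    unfolding H by (auto simp: closed_halfspace_le convex_halfspace_le)
  {
    assume "z \<in> H"
    then have "(u - v) \<bullet> (z - v) \<le> 0"
      unfolding v_def using cc by (intro closest_point_dot)
    moreover have "(norm (u - z))\<^sup>2 = (norm (u - v))\<^sup>2 + (norm (v - z))\<^sup>2 - 2 * ((u - v) \<bullet> (z - v))"
      by (simp add: power2_norm_eq_inner inner_diff_left inner_diff_right inner_commute)
    ultimately show "(norm (v - z))\<^sup>2 \<le> (norm (u - z))\<^sup>2 - (norm (u - v))\<^sup>2"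
      by linarith
  }
  have "v \<in> H"
    unfolding v_def using cc ne by (intro closest_point_in_set) auto
  then have "(u - b) \<bullet> e \<le> (u - v) \<bullet> e"
    by (simp add: H_def inner_diff_left)
  also have "\<dots> \<le> norm (u - v) * norm e"
    by (rule norm_cauchy_schwarz)
  finally show "(u - b) \<bullet> e \<le> norm (u - v) * norm e" .
qed

text \<open>
  Acceptance gives \<open>(u - b) \<bullet> E b \<ge> rho P * (\<mu> * norm d)\<^sup>2\<close>, which is of the order of the squared
  residual norm since \<open>d\<close> is not too short. Dividing by \<open>norm (E b) \<le> (1 + L) * norm (E u)\<close>
  leaves a multiple of the residual norm.
\<close>

lemma projection_step_length:
  fixes E :: "'a::euclidean_space \<Rightarrow> 'a"
  assumes lip: "L-lipschitz_on UNIV E" and "L > 0" and params: "valid_params P"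
    and E: "E u \<noteq> 0" and adm: "admissible_direction P (E u) d"
    and m: "0 < m" "m \<le> \<mu>" "\<mu> \<le> 1" and acc: "accepted E P u d \<mu>"
  defines "b \<equiv> u + \<mu> *\<^sub>R d"
  shows "rho P * m\<^sup>2 * (zeta P)\<^sup>2 / (1 + L) * norm (E u)
    \<le> norm (u - closest_point {v. (v - b) \<bullet> E b \<le> 0} u)" (is "?K / (1 + L) * _ \<le> ?s")
proof -
  have pos: "0 < rho P" "0 < zeta P"
    using params by (auto simp: valid_params_def)
  have d: "norm d \<le> norm (E u)" "zeta P * norm (E u) \<le> norm d"
    using adm by (auto simp: admissible_direction_def)
  have "norm (E b) \<le> norm (E u) + norm (E b - E u)"
    by (metis add.commute diff_add_cancel norm_triangle_ineq)
  also have "norm (E b - E u) \<le> L * (\<mu> * norm d)"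
    using lipschitz_onD[OF lip, of b u] m by (simp add: dist_norm b_def)
  also have "\<mu> * norm d \<le> 1 * norm (E u)"
    using m d by (intro mult_mono) auto
  finally have Eb: "norm (E b) \<le> (1 + L) * norm (E u)"
    using \<open>L > 0\<close> by (simp add: algebra_simps)
  have "?K * (norm (E u))\<^sup>2 = rho P * (m\<^sup>2 * (zeta P * norm (E u))\<^sup>2)"
    by (simp add: power_mult_distrib)
  also have "\<dots> \<le> rho P * (\<mu>\<^sup>2 * (norm d)\<^sup>2)"
    using m d pos by (intro mult_left_mono mult_mono power_mono) auto
  also have "\<dots> \<le> \<mu> * - (d \<bullet> E b)"
  proof -
    have "rho P * \<mu> * (norm d)\<^sup>2 \<le> - (d \<bullet> E b)"
      using acc by (simp add: accepted_def b_def)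
    then have "\<mu> * (rho P * \<mu> * (norm d)\<^sup>2) \<le> \<mu> * - (d \<bullet> E b)"
      by (rule mult_left_mono) (use m in simp)
    then show ?thesis
      by (simp add: power2_eq_square mult_ac)
  qed
  also have "\<dots> = (u - b) \<bullet> E b"
    by (simp add: b_def)
  also have "\<dots> \<le> ?s * norm (E b)"
    by (rule halfspace_projection)
  also have "\<dots> \<le> ?s * ((1 + L) * norm (E u))"
    by (rule mult_left_mono[OF Eb]) simp
  finally have "?K * norm (E u) * norm (E u) \<le> ?s * (1 + L) * norm (E u)"
    by (simp add: power2_eq_square mult_ac)
  then have "?K * norm (E u) \<le> ?s * (1 + L)"
    using E by (simp add: mult_le_cancel_right)
  then show ?thesis
    using \<open>L > 0\<close> by (simp add: field_simps)
qed

text \<open>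
  The constant does not depend on the solution \<open>z\<close>: every solution lies in every projection
  half-space, because \<open>E b \<bullet> (b - z) \<ge> 0\<close> by monotonicity and \<open>E z = 0\<close>.
\<close>

lemma subspace_run_fejer:
  fixes E :: "'a::euclidean_space \<Rightarrow> 'a"
  assumes mono: "\<And>u v. (E u - E v) \<bullet> (u - v) \<ge> 0"
    and lip: "L-lipschitz_on UNIV E" and "L > 0" and params: "valid_params P"
    and S: "valid_step_rule P L S" and run: "subspace_run E P F S x p psc \<mu>"
  shows "\<exists>c>0. \<forall>z l. E z = 0 \<longrightarrow>
    (norm (x (Suc l) - z))\<^sup>2 \<le> (norm (x l - z))\<^sup>2 - c * (norm (E (x l)))\<^sup>2"
proof -
  obtain m where m: "m > 0" "\<And>l. m \<le> \<mu> l" "\<And>l. \<mu> l \<le> 1"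
    "\<And>l. accepted E P (x l) (psc l) (\<mu> l)"
    using step_sizes_accepted[OF lip \<open>L > 0\<close> params S run] by blast
  define k where "k = rho P * m\<^sup>2 * (zeta P)\<^sup>2 / (1 + L)"
  have "k > 0"
    using params m(1) \<open>L > 0\<close> by (simp add: k_def valid_params_def)
  have "(norm (x (Suc l) - z))\<^sup>2 \<le> (norm (x l - z))\<^sup>2 - k\<^sup>2 * (norm (E (x l)))\<^sup>2"
    if z: "E z = 0" for z l
  proof -
    define b where "b = x l + \<mu> l *\<^sub>R psc l"
    have E: "E (x l) \<noteq> 0" and next_x: "x (Suc l) = closest_point {v. (v - b) \<bullet> E b \<le> 0} (x l)"
      using run by (auto simp: subspace_run_def trial_point_def b_def)
    have "k * norm (E (x l)) \<le> norm (x l - x (Suc l))"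
      unfolding k_def next_x b_def
      by (rule projection_step_length[OF lip \<open>L > 0\<close> params E subspace_run_admissible[OF params run]])
        (use m in auto)
    then have "(k * norm (E (x l)))\<^sup>2 \<le> (norm (x l - x (Suc l)))\<^sup>2"
      by (rule power_mono) (use \<open>k > 0\<close> in simp)
    moreover have "z \<in> {v. (v - b) \<bullet> E b \<le> 0}"
      using mono[of b z] z by (simp add: inner_commute[of "E b"] inner_diff_left)
    then have "(norm (x (Suc l) - z))\<^sup>2 \<le> (norm (x l - z))\<^sup>2 - (norm (x l - x (Suc l)))\<^sup>2"
      unfolding next_x by (rule halfspace_projection)
    ultimately show ?thesis
      by (simp add: power_mult_distrib)
  qed
  then show ?thesis
    using \<open>k > 0\<close> by (intro exI[of _ "k\<^sup>2"]) auto
qed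


section \<open>Best iterates\<close>

text \<open>
  If the first \<open>N = \<lceil>C / \<epsilon>\<^sup>2\<rceil>\<close> residuals all exceeded \<open>\<epsilon>\<close>, their squares would sum to more than
  \<open>C\<close>. Indices start at zero, whence the bound \<open>N - 1\<close>; positivity of \<open>C\<close> guarantees \<open>N > 0\<close>
  even for large \<open>\<epsilon>\<close>.
\<close>

lemma best_iterate_of_summable_residuals:
  fixes E :: "'a::euclidean_space \<Rightarrow> 'a"
  assumes sum: "\<And>n. (\<Sum>l<n. (norm (E (x l)))\<^sup>2) \<le> C" and "0 < C" "0 < \<epsilon>"
  shows "\<exists>k. best_iterate_index E x C \<epsilon> k"
proof -
  define N where "N = nat \<lceil>C / \<epsilon>\<^sup>2\<rceil>"
  have "C / \<epsilon>\<^sup>2 > 0"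
    using assms by simp
  then have N: "int N = \<lceil>C / \<epsilon>\<^sup>2\<rceil>" "N > 0"
    unfolding N_def by linarith+
  have "\<exists>k<N. norm (E (x k)) \<le> \<epsilon>"
  proof (rule ccontr)
    assume "\<not> ?thesis"
    then have "\<epsilon>\<^sup>2 < (norm (E (x k)))\<^sup>2" if "k < N" for k
      using that \<open>0 < \<epsilon>\<close> by (intro power_strict_mono) auto
    then have "(\<Sum>k<N. \<epsilon>\<^sup>2) < (\<Sum>k<N. (norm (E (x k)))\<^sup>2)"
      using N(2) by (intro sum_strict_mono) auto
    then have "real N * \<epsilon>\<^sup>2 < C"
      using sum[of N] by simp
    moreover have "C / \<epsilon>\<^sup>2 \<le> real N"
      using N(1) by linarith
    ultimately show False
      using \<open>0 < \<epsilon>\<close> by (simp add: divide_le_eq)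
  qed
  then show ?thesis
    using N by (auto simp: best_iterate_index_def)
qed

text \<open>
  The Fejer inequality telescopes.
\<close>

lemma fejer_residuals_summable:
  fixes E :: "'a::euclidean_space \<Rightarrow> 'a"
  assumes "c > 0"
    and "\<And>l. (norm (x (Suc l) - z))\<^sup>2 \<le> (norm (x l - z))\<^sup>2 - c * (norm (E (x l)))\<^sup>2"
  shows "(\<Sum>l<n. (norm (E (x l)))\<^sup>2) \<le> (norm (x 0 - z))\<^sup>2 / c"
proof -
  have "c * (\<Sum>l<n. (norm (E (x l)))\<^sup>2) \<le> (norm (x 0 - z))\<^sup>2 - (norm (x n - z))\<^sup>2"
  proof (induction n)
    case (Suc n)
    then show ?case
      using assms(2)[of n] by (simp add: distrib_left)
  qed simp
  then have "c * (\<Sum>l<n. (norm (E (x l)))\<^sup>2) \<le> (norm (x 0 - z))\<^sup>2"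
    by (smt (verit) zero_le_power2)
  then show ?thesis
    using assms(1) by (simp add: pos_le_divide_eq mult.commute)
qed


section \<open>The local linear regime\<close>

text \<open>
  A kernel vector would make \<open>0\<close> a singular value, and no singular value is smaller.
\<close>

lemma sigma_min_pos_imp_inj:
  fixes A :: "real^'n^'n"
  assumes "sigma_min A > 0" "A *v v = 0"
  shows "v = 0"
proof (rule ccontr)
  assume "v \<noteq> 0"
  moreover have "(transpose A ** A) *v v = 0"
    by (simp only: matrix_vector_mul_assoc[symmetric] assms(2) matrix_vector_mult_0_right)
  ultimately have "singular_value A 0"
    unfolding singular_value_def by (intro conjI exI[of _ v]) auto
  then have "sigma_min A = 0"
    unfolding sigma_min_def by (rule Least_equality) (simp add: singular_value_def)
  then show False
    using assms(1) by simp
qed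

text \<open>
  An injective linear map on a finite-dimensional space satisfies \<open>B * norm v \<le> norm (A *v v)\<close> for
  some \<open>B > 0\<close>. Near \<open>z\<close> the linearization error is at most half of this, so \<open>m = B / 2\<close> works.
\<close>

lemma local_error_bound:
  fixes E :: "real^'n \<Rightarrow> real^'n"
  assumes "E z = 0" "C1_near E z" "sigma_min (jacobian E (at z)) > 0"
  shows "\<exists>m>0. \<forall>\<^sub>F v in nhds z. m * norm (v - z) \<le> norm (E v)"
proof -
  let ?A = "jacobian E (at z)"
  obtain U where U: "open U" "z \<in> U" "E differentiable_on U"
    using assms(2) by (auto simp: C1_near_def)
  then have "E differentiable at z"
    using at_within_open[OF U(2,1)] by (auto simp: differentiable_on_def)
  then have der: "(E has_derivative (\<lambda>v. ?A *v v)) (at z)"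
    by (simp add: jacobian_works)
  have "inj ((*v) ?A)"
    unfolding linear_injective_0[OF matrix_vector_mul_linear]
    using sigma_min_pos_imp_inj[OF assms(3)] by blast
  then obtain B where B: "B > 0" "\<And>v. B * norm v \<le> norm (?A *v v)"
    using linear_inj_bounded_below_pos[OF matrix_vector_mul_linear] by blast
  obtain r where r: "r > 0"
    "\<And>v. norm (v - z) < r \<Longrightarrow> norm (E v - E z - ?A *v (v - z)) \<le> B / 2 * norm (v - z)"
    using der[unfolded has_derivative_at_alt, THEN conjunct2, rule_format, OF half_gt_zero[OF B(1)]]
    by blast
  have "B / 2 * norm (v - z) \<le> norm (E v)" if "dist v z < r" for v
  proof -
    have "B * norm (v - z) \<le> norm (E v) + norm (E v - ?A *v (v - z))"
      using B(2)[of "v - z"] norm_triangle_ineq4[of "E v" "E v - ?A *v (v - z)"] by simp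
    then show ?thesis
      using r(2)[of v] that assms(1) by (simp add: dist_norm)
  qed
  then show ?thesis
    using B(1) r(1) unfolding eventually_nhds_metric by (intro exI[of _ "B / 2"]) auto
qed

text \<open>
  The error bound turns the decrease of the squared distance into contraction by \<open>1 - c * m\<^sup>2\<close>.
\<close>

lemma fejer_geometric:
  fixes E :: "'a::euclidean_space \<Rightarrow> 'a"
  assumes "c > 0" "m > 0"
    and fejer: "\<And>l. (norm (x (Suc l) - z))\<^sup>2 \<le> (norm (x l - z))\<^sup>2 - c * (norm (E (x l)))\<^sup>2"
    and bound: "\<And>l. l0 \<le> l \<Longrightarrow> m * norm (x l - z) \<le> norm (E (x l))"
  shows "\<exists>q. 0 < q \<and> q < 1 \<and> (\<forall>j. norm (x (l0 + j) - z) \<le> norm (x l0 - z) * q ^ j)"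
proof -
  \<comment> \<open>\<open>1 - c * m\<^sup>2\<close> need not be positive; any lower cutoff in \<open>(0, 1)\<close> keeps \<open>q\<close> positive.\<close>
  define q where "q = sqrt (max (1 - c * m\<^sup>2) (1 / 4))"
  have q: "0 < q" "q < 1"
    using assms(1,2) unfolding q_def by (auto intro: real_sqrt_gt_zero simp: less_max_iff_disj)
  have q2: "1 - c * m\<^sup>2 \<le> q\<^sup>2"
    unfolding q_def by (subst real_sqrt_pow2) auto
  have step: "norm (x (Suc l) - z) \<le> q * norm (x l - z)" if "l0 \<le> l" for l
  proof (rule power2_le_imp_le)
    have "(m * norm (x l - z))\<^sup>2 \<le> (norm (E (x l)))\<^sup>2"
      using bound[OF that] \<open>m > 0\<close> by (intro power_mono) auto
    then have "c * (m * norm (x l - z))\<^sup>2 \<le> c * (norm (E (x l)))\<^sup>2"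
      using \<open>c > 0\<close> by simp
    then have "(norm (x (Suc l) - z))\<^sup>2 \<le> (1 - c * m\<^sup>2) * (norm (x l - z))\<^sup>2"
      using fejer[of l] by (simp add: power_mult_distrib algebra_simps)
    also have "\<dots> \<le> q\<^sup>2 * (norm (x l - z))\<^sup>2"
      using q2 by (rule mult_right_mono) simp
    finally show "(norm (x (Suc l) - z))\<^sup>2 \<le> (q * norm (x l - z))\<^sup>2"
      by (simp add: power_mult_distrib)
  qed (use q in simp)
  have "norm (x (l0 + j) - z) \<le> norm (x l0 - z) * q ^ j" for j
  proof (induction j)
    case (Suc j)
    have "norm (x (l0 + Suc j) - z) \<le> q * norm (x (l0 + j) - z)"
      using step[of "l0 + j"] by simp
    also have "\<dots> \<le> q * (norm (x l0 - z) * q ^ j)"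
      using Suc q by (intro mult_left_mono) auto
    finally show ?case
      by (simp add: mult_ac)
  qed simp
  then show ?thesis
    using q by blast
qed

lemma linear_regime_of_geometric_decay:
  fixes E :: "'a::euclidean_space \<Rightarrow> 'a"
  assumes q: "0 < q" "q < 1" and "0 < C" and decay: "\<And>j. norm (E (x (l0 + j))) \<le> C * q ^ j"
  shows "linear_regime E x l0 q C"
proof -
  have "(\<exists>l\<ge>l0. norm (E (x l)) \<le> \<epsilon>) \<and> int (first_index E x l0 \<epsilon>) \<le> linear_bound l0 q C \<epsilon>"
    if "\<epsilon> > 0" for \<epsilon>
  proof -
    define n where "n = nat \<lceil>ln (C / \<epsilon>) / ln (1 / q)\<rceil>"
    have "C * q ^ n \<le> \<epsilon>"
      unfolding n_def using assms that by (intro geometric_decay_le) (auto intro: real_nat_ceiling_ge)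
    then have small: "l0 \<le> l0 + n \<and> norm (E (x (l0 + n))) \<le> \<epsilon>"
      using decay[of n] by simp
    then have "first_index E x l0 \<epsilon> \<le> l0 + n"
      unfolding first_index_def by (rule Least_le)
    moreover have "int (l0 + n) = linear_bound l0 q C \<epsilon>"
      unfolding linear_bound_def n_def by simp
    ultimately show ?thesis
      using small by (intro conjI exI[of _ "l0 + n"]) linarith+
  qed
  then show ?thesis
    using assms by (simp add: linear_regime_def)
qed


section \<open>Asymptotics as the accuracy tends to zero\<close>

text \<open>
  For \<open>\<epsilon> < exp (-1)\<close> the comparison function \<open>ln (1 / \<epsilon>)\<close> is at least \<open>1\<close> and therefore absorbs
  all constants in the bound.
\<close>

lemma linear_bound_bigo:
  assumes "0 < q" "q < 1" "0 < C"
  shows "(\<lambda>\<epsilon>. real_of_int (linear_bound l0 q C \<epsilon>)) \<in> O[at_right 0](\<lambda>\<epsilon>. ln (1 / \<epsilon>))"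
proof -
  define a where "a = ln (1 / q)"
  define K where "K = real l0 + 1 + \<bar>ln C\<bar> / a + 1 / a"
  have a: "a > 0"
    using assms by (simp add: a_def)
  have K: "0 < K"
    using a by (simp add: K_def add_pos_nonneg)
  have "norm (real_of_int (linear_bound l0 q C \<epsilon>)) \<le> K * norm (ln (1 / \<epsilon>))"
    if e: "0 < \<epsilon>" "\<epsilon> < exp (-1)" for \<epsilon> :: real
  proof -
    define t where "t = ln (1 / \<epsilon>)"
    have "ln \<epsilon> < -1"
      using e by (metis ln_less_cancel_iff exp_gt_zero ln_exp)
    then have t: "1 \<le> t"
      using e by (simp add: t_def ln_div)
    have "ln (C / \<epsilon>) / a = ln C / a + t / a"
      using e assms by (simp add: t_def ln_div diff_divide_distrib add_divide_distrib)
    moreover have "ln C / a \<le> \<bar>ln C\<bar> / a" "0 \<le> \<bar>ln C\<bar> / a" "0 \<le> t / a"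
      using a t by (auto intro: divide_right_mono)
    ultimately have "real_of_int (linear_bound l0 q C \<epsilon>) \<le> real l0 + 1 + \<bar>ln C\<bar> / a + t / a"
      unfolding linear_bound_def a_def[symmetric] by linarith
    also have "\<dots> \<le> (real l0 + 1 + \<bar>ln C\<bar> / a) * t + t / a"
      using t a mult_left_mono[of 1 t "real l0 + 1 + \<bar>ln C\<bar> / a"] by simp
    also have "\<dots> = K * t"
      by (simp add: K_def algebra_simps)
    finally show ?thesis
      using t by (simp add: t_def[symmetric] linear_bound_def)
  qed
  then have "\<forall>\<^sub>F \<epsilon> in at_right 0.
      norm (real_of_int (linear_bound l0 q C \<epsilon>)) \<le> K * norm (ln (1 / \<epsilon>))"
    unfolding eventually_at_right_field by (intro exI[of _ "exp (-1)"]) auto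
  then show ?thesis
    by (rule bigoI)
qed

lemma ceiling_inverse_square_bigo:
  assumes "0 < C"
  shows "(\<lambda>\<epsilon>. real_of_int (\<lceil>C / \<epsilon>\<^sup>2\<rceil> - 1)) \<in> O[at_right 0](\<lambda>\<epsilon>. 1 / \<epsilon>\<^sup>2)"
proof (rule bigoI)
  have "norm (real_of_int (\<lceil>C / \<epsilon>\<^sup>2\<rceil> - 1)) \<le> C * norm (1 / \<epsilon>\<^sup>2)" if "0 < \<epsilon>" for \<epsilon> :: real
  proof -
    have "0 < C / \<epsilon>\<^sup>2"
      using assms that by simp
    then have "0 < \<lceil>C / \<epsilon>\<^sup>2\<rceil>"
      by (simp only: zero_less_ceiling)
    then have "0 \<le> real_of_int (\<lceil>C / \<epsilon>\<^sup>2\<rceil> - 1)"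
      by simp
    moreover have "real_of_int (\<lceil>C / \<epsilon>\<^sup>2\<rceil> - 1) \<le> C / \<epsilon>\<^sup>2"
      by linarith
    ultimately show ?thesis
      by simp
  qed
  then show "\<forall>\<^sub>F \<epsilon> in at_right 0. norm (real_of_int (\<lceil>C / \<epsilon>\<^sup>2\<rceil> - 1)) \<le> C * norm (1 / \<epsilon>\<^sup>2)"
    unfolding eventually_at_right_field by (intro exI[of _ 1]) auto
qed

text \<open>
  With \<open>c \<ge> 1\<close> and an index of order \<open>f\<close>, the count \<open>(c + 1) * (k + 1)\<close> is of order \<open>c * f\<close>, as
  soon as \<open>f\<close> also dominates the constant \<open>1\<close>.
\<close>

lemma evaluations_bigo:
  fixes N :: "nat \<Rightarrow> nat" and c :: int and k :: "real \<Rightarrow> nat" and b :: "real \<Rightarrow> int"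
  assumes c: "c \<ge> 1" and N: "\<And>l. int (N l) \<le> (c + 1) * (int l + 1)"
    and k: "\<And>\<epsilon>. 0 < \<epsilon> \<Longrightarrow> int (k \<epsilon>) \<le> b \<epsilon>"
    and b: "(\<lambda>\<epsilon>. real_of_int (b \<epsilon>)) \<in> O[at_right 0](f)"
    and one: "(\<lambda>_. 1) \<in> O[at_right 0](f)"
  shows "(\<lambda>\<epsilon>. real (N (k \<epsilon>))) \<in> O[at_right 0](\<lambda>\<epsilon>. of_int c * f \<epsilon>)"
proof -
  have "norm (real (N (k \<epsilon>))) \<le> 2 * norm (of_int c * (real_of_int (b \<epsilon>) + 1))"
    if "0 < \<epsilon>" for \<epsilon>
  proof -
    have "int (N (k \<epsilon>)) \<le> (c + 1) * (int (k \<epsilon>) + 1)"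
      by (rule N)
    also have "\<dots> \<le> (2 * c) * (b \<epsilon> + 1)"
      using c k[OF that] by (intro mult_mono) auto
    finally have "real_of_int (int (N (k \<epsilon>))) \<le> real_of_int ((2 * c) * (b \<epsilon> + 1))"
      by (rule of_int_le_iff[THEN iffD2])
    then have "real (N (k \<epsilon>)) \<le> 2 * (of_int c * (real_of_int (b \<epsilon>) + 1))"
      by (simp add: mult_ac)
    also have "\<dots> \<le> 2 * norm (of_int c * (real_of_int (b \<epsilon>) + 1))"
      by simp
    finally show ?thesis
      by simp
  qed
  then have "(\<lambda>\<epsilon>. real (N (k \<epsilon>))) \<in> O[at_right 0](\<lambda>\<epsilon>. of_int c * (real_of_int (b \<epsilon>) + 1))"
    by (intro bigoI[where c = 2]) (auto simp: eventually_at_right_field intro: exI[of _ 1])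
  also have "(\<lambda>\<epsilon>. of_int c * (real_of_int (b \<epsilon>) + 1)) \<in> O[at_right 0](\<lambda>\<epsilon>. of_int c * f \<epsilon>)"
    by (intro landau_o.big.mult landau_o.big_refl sum_in_bigo b one)
  finally show ?thesis .
qed

lemma one_bigo_inverse_square: "(\<lambda>_. 1) \<in> O[at_right (0::real)](\<lambda>\<epsilon>. 1 / \<epsilon>\<^sup>2)"
proof (rule bigoI[where c = 1])
  have "norm (1::real) \<le> 1 * norm (1 / \<epsilon>\<^sup>2)" if "0 < \<epsilon>" "\<epsilon> < 1" for \<epsilon> :: real
    using that by (simp add: power_le_one)
  then show "\<forall>\<^sub>F \<epsilon> in at_right 0. norm (1::real) \<le> 1 * norm (1 / \<epsilon>\<^sup>2 :: real)"
    unfolding eventually_at_right_field by (intro exI[of _ 1]) auto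
qed

lemma one_bigo_ln_inverse: "(\<lambda>_. 1) \<in> O[at_right (0::real)](\<lambda>\<epsilon>. ln (1 / \<epsilon>))"
proof (rule bigoI[where c = 1])
  have "norm (1::real) \<le> 1 * norm (ln (1 / \<epsilon>))" if "0 < \<epsilon>" "\<epsilon> < exp (-1)" for \<epsilon> :: real
  proof -
    have "ln \<epsilon> < -1"
      using that by (metis ln_less_cancel_iff exp_gt_zero ln_exp)
    then show ?thesis
      using that by (simp add: ln_div)
  qed
  then show "\<forall>\<^sub>F \<epsilon> in at_right 0. norm (1::real) \<le> 1 * norm (ln (1 / \<epsilon>) :: real)"
    unfolding eventually_at_right_field by (intro exI[of _ "exp (-1)"]) auto
qed

lemma N_eval_le:
  fixes E :: "'a::euclidean_space \<Rightarrow> 'a"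
  assumes "\<And>l. int (ls_evals E P \<gamma> \<mu>init \<mu>min (x l) (psc l)) \<le> c" "\<And>l. extra l \<le> 1"
  shows "int (N_eval E P \<gamma> \<mu>init \<mu>min x psc extra l) \<le> (c + 1) * (int l + 1)"
proof -
  have "int (N_eval E P \<gamma> \<mu>init \<mu>min x psc extra l)
      = (\<Sum>i\<le>l. int (ls_evals E P \<gamma> \<mu>init \<mu>min (x i) (psc i)) + int (extra i))"
    by (simp add: N_eval_def)
  also have "\<dots> \<le> (\<Sum>i\<le>l. c + 1)"
    by (intro sum_mono add_mono assms(1)) (use assms(2) in auto)
  finally show ?thesis
    by (simp add: algebra_simps)
qed


section \<open>The complexity theorem\<close>

theorem theorem5:
  fixes E :: "real^'n \<Rightarrow> real^'n"
    and x p psc :: "nat \<Rightarrow> real^'n"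
    and \<mu> :: "nat \<Rightarrow> real"
    and L :: real
    and P :: alg_params
    and F :: direction_family
    and S :: step_rule
  assumes mono: "\<And>u v. (E u - E v) \<bullet> (u - v) \<ge> 0"
    and L_pos: "L > 0"
    and lipschitz: "L-lipschitz_on UNIV E"
    and solvable: "{z. E z = 0} \<noteq> {}"
    and params: "valid_params P"
    and step_rule: "valid_step_rule P L S"
    and run: "subspace_run E P F S x p psc \<mu>"
  shows
    "(\<exists>C_sub>0.
        (\<forall>\<epsilon>>0. \<exists>k. best_iterate_index E x C_sub \<epsilon> k) \<and>
        (\<lambda>\<epsilon>. real_of_int (\<lceil>C_sub / \<epsilon>\<^sup>2\<rceil> - 1)) \<in> O[at_right 0](\<lambda>\<epsilon>. 1 / \<epsilon>\<^sup>2))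
     \<and>
     (\<forall>xstar. E xstar = 0 \<and> x \<longlonglongrightarrow> xstar \<and> C1_near E xstar \<and> sigma_min (jacobian E (at xstar)) > 0
        \<longrightarrow> (\<exists>l0 q C_lin. linear_regime E x l0 q C_lin \<and>
              (\<lambda>\<epsilon>. real_of_int (linear_bound l0 q C_lin \<epsilon>)) \<in> O[at_right 0](\<lambda>\<epsilon>. ln (1 / \<epsilon>))))
     \<and>
     (\<forall>\<gamma> \<mu>init \<mu>min.
        S = Line_Search \<gamma> \<mu>init \<mu>min \<and> \<mu>min = min \<mu>init (Delta_a P / (\<gamma> * (L + rho P)))
        \<longrightarrow> 0 < \<mu>min \<and> (\<forall>l. \<mu>min \<le> \<mu> l) \<and>
            (\<forall>l. int (ls_evals E P \<gamma> \<mu>init \<mu>min (x l) (psc l)) \<le> C_LS \<gamma> \<mu>init \<mu>min) \<and>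
            (\<forall>extra. (\<forall>l. extra l \<le> 1) \<longrightarrow>
               (\<forall>l. int (N_eval E P \<gamma> \<mu>init \<mu>min x psc extra l)
                      \<le> (C_LS \<gamma> \<mu>init \<mu>min + 1) * (int l + 1)) \<and>
               (\<forall>C_sub>0. \<forall>k. (\<forall>\<epsilon>>0. best_iterate_index E x C_sub \<epsilon> (k \<epsilon>)) \<longrightarrow>
                  (\<lambda>\<epsilon>. real (N_eval E P \<gamma> \<mu>init \<mu>min x psc extra (k \<epsilon>)))
                    \<in> O[at_right 0](\<lambda>\<epsilon>. of_int (C_LS \<gamma> \<mu>init \<mu>min) * (1 / \<epsilon>\<^sup>2))) \<and>
               (\<forall>xstar. E xstar = 0 \<and> x \<longlonglongrightarrow> xstar \<and> C1_near E xstar \<and>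
                        sigma_min (jacobian E (at xstar)) > 0 \<longrightarrow>
                  (\<forall>l0 q C_lin. linear_regime E x l0 q C_lin \<longrightarrow>
                     (\<lambda>\<epsilon>. real (N_eval E P \<gamma> \<mu>init \<mu>min x psc extra (first_index E x l0 \<epsilon>)))
                       \<in> O[at_right 0](\<lambda>\<epsilon>. of_int (C_LS \<gamma> \<mu>init \<mu>min) * ln (1 / \<epsilon>))))))"
proof (intro conjI allI impI; (elim conjE)?)
  obtain c where c: "c > 0" and fejer: "\<And>z l. E z = 0 \<Longrightarrow>
      (norm (x (Suc l) - z))\<^sup>2 \<le> (norm (x l - z))\<^sup>2 - c * (norm (E (x l)))\<^sup>2"
    using subspace_run_fejer[OF mono lipschitz L_pos params step_rule run] by blast
  have E_nz: "E (x l) \<noteq> 0" for l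
    using run by (simp add: subspace_run_def)
  show "\<exists>C_sub>0. (\<forall>\<epsilon>>0. \<exists>k. best_iterate_index E x C_sub \<epsilon> k) \<and>
        (\<lambda>\<epsilon>. real_of_int (\<lceil>C_sub / \<epsilon>\<^sup>2\<rceil> - 1)) \<in> O[at_right 0](\<lambda>\<epsilon>. 1 / \<epsilon>\<^sup>2)"
  proof -
    obtain z where z: "E z = 0"
      using solvable by auto
    define C where "C = (norm (x 0 - z))\<^sup>2 / c"
    have "x 0 \<noteq> z"
      using E_nz z by metis
    then have "C > 0"
      using c by (simp add: C_def)
    moreover have "(\<Sum>l<n. (norm (E (x l)))\<^sup>2) \<le> C" for n
      unfolding C_def by (rule fejer_residuals_summable) (use c fejer[OF z] in auto)
    ultimately show ?thesis
      by (intro exI[of _ C] conjI allI impI best_iterate_of_summable_residuals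
          ceiling_inverse_square_bigo)
  qed
  \<comment> \<open>From \<open>l0\<close> on, the iterates stay in the neighbourhood where the error bound holds.\<close>
  show "\<exists>l0 q C_lin. linear_regime E x l0 q C_lin \<and>
      (\<lambda>\<epsilon>. real_of_int (linear_bound l0 q C_lin \<epsilon>)) \<in> O[at_right 0](\<lambda>\<epsilon>. ln (1 / \<epsilon>))"
    if z: "E z = 0" and lim: "x \<longlonglongrightarrow> z" and reg: "C1_near E z" "sigma_min (jacobian E (at z)) > 0"
    for z
  proof -
    obtain m where m: "m > 0" "\<forall>\<^sub>F v in nhds z. m * norm (v - z) \<le> norm (E v)"
      using local_error_bound[OF z reg] by blast
    have "\<forall>\<^sub>F l in sequentially. m * norm (x l - z) \<le> norm (E (x l))"
      using filterlim_iff[THEN iffD1, OF lim] m(2) by blast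
    then obtain l0 where bound: "\<And>l. l0 \<le> l \<Longrightarrow> m * norm (x l - z) \<le> norm (E (x l))"
      by (auto simp: eventually_sequentially)
    obtain q where q: "0 < q" "q < 1" and decay: "\<And>j. norm (x (l0 + j) - z) \<le> norm (x l0 - z) * q ^ j"
      using fejer_geometric[of c m x z E l0] c m(1) fejer[OF z] bound by blast
    define C where "C = L * norm (x l0 - z)"
    have "x l0 \<noteq> z"
      using E_nz z by metis
    then have "C > 0"
      using L_pos by (simp add: C_def)
    moreover have "norm (E (x (l0 + j))) \<le> C * q ^ j" for j
    proof -
      have "norm (E (x (l0 + j))) \<le> L * norm (x (l0 + j) - z)"
        using lipschitz_onD[OF lipschitz, of "x (l0 + j)" z] z by (simp add: dist_norm)
      also have "\<dots> \<le> L * (norm (x l0 - z) * q ^ j)"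
        using decay L_pos by (intro mult_left_mono) auto
      finally show ?thesis
        by (simp add: C_def mult_ac)
    qed
    ultimately show ?thesis
      using q by (intro exI[of _ l0] exI[of _ q] exI[of _ C] conjI
          linear_regime_of_geometric_decay linear_bound_bigo)
  qed
  fix \<gamma> \<mu>init \<mu>min
  assume S: "S = Line_Search \<gamma> \<mu>init \<mu>min"
  have ls: "1 < \<gamma>" "0 < \<mu>min" "\<mu>min \<le> \<mu>init" "\<mu>min \<le> Delta_a P / (L + rho P)"
    using step_rule S by auto
  show "0 < \<mu>min"
    by (fact ls)
  show "\<mu>min \<le> \<mu> l" for l
  proof (rule line_search_step_ge)
    show "is_step_size E P (Line_Search \<gamma> \<mu>init \<mu>min) (x l) (psc l) (\<mu> l)"
      using run unfolding subspace_run_def S by blast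
  qed (fact ls)+
  show evals: "int (ls_evals E P \<gamma> \<mu>init \<mu>min (x l) (psc l)) \<le> C_LS \<gamma> \<mu>init \<mu>min" for l
    using ls subspace_run_admissible[OF params run]
    by (intro ls_evals_le accepted_if_short_step[OF lipschitz L_pos params]) auto
  have C1: "1 \<le> C_LS \<gamma> \<mu>init \<mu>min"
    using evals[of 0] by (simp add: ls_evals_def)
  fix extra :: "nat \<Rightarrow> nat"
  assume "\<forall>l. extra l \<le> 1"
  then show N: "int (N_eval E P \<gamma> \<mu>init \<mu>min x psc extra l)
      \<le> (C_LS \<gamma> \<mu>init \<mu>min + 1) * (int l + 1)" for l
    by (intro N_eval_le evals) auto
  show "(\<lambda>\<epsilon>. real (N_eval E P \<gamma> \<mu>init \<mu>min x psc extra (k \<epsilon>)))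
      \<in> O[at_right 0](\<lambda>\<epsilon>. of_int (C_LS \<gamma> \<mu>init \<mu>min) * (1 / \<epsilon>\<^sup>2))"
    if "C_sub > 0" "\<forall>\<epsilon>>0. best_iterate_index E x C_sub \<epsilon> (k \<epsilon>)" for C_sub k
    using that
    by (intro evaluations_bigo[OF C1 N _ ceiling_inverse_square_bigo one_bigo_inverse_square])
      (auto simp: best_iterate_index_def)
  show "(\<lambda>\<epsilon>. real (N_eval E P \<gamma> \<mu>init \<mu>min x psc extra (first_index E x l0 \<epsilon>)))
      \<in> O[at_right 0](\<lambda>\<epsilon>. of_int (C_LS \<gamma> \<mu>init \<mu>min) * ln (1 / \<epsilon>))"
    if "linear_regime E x l0 q C_lin" for l0 q C_lin
    using that
    by (intro evaluations_bigo[OF C1 N _ linear_bound_bigo one_bigo_ln_inverse])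
      (auto simp: linear_regime_def)
qed

end
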